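(* Let $\mathscr{H}$ be a complex Hilbert space, let $A,B,X\in\mathbb{B}(\mathscr{H})$ be such that $A,B$ are positive, let $r\geq2$, $0\leq\nu\leq1$ and $N\in\mathbb{N}$. Then $$w^r(A^\nu XB^{1-\nu})\leq\|X\|^r\Big[\|\nu A^r+(1-\nu)B^r\|-\inf_{\|x\|=1}\eta(x)\Big],$$ where $$\eta(x)=\sum_{j=1}^N\Big((-1)^{r_j}2^{j-1}\nu+(-1)^{r_j+1}\Big\lfloor\frac{r_j+1}{2}\Big\rfloor\Big)\Big(\sqrt[2^j]{\langle B^rx,x\rangle^{2^{j-1}-k_j}\langle A^rx,x\rangle^{k_j}}-\sqrt[2^j]{\langle A^rx,x\rangle^{k_j+1}\langle B^rx,x\rangle^{2^{j-1}-k_j-1}}\Big)^2,$$ with $r_j=\lfloor2^j\nu\rfloor$ and $k_j=\lfloor2^{j-1}\nu\rfloor$.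
   Context: $\mathbb{B}(\mathscr{H})$ is the algebra of bounded linear operators on $\mathscr{H}$ with the operator norm $\|\cdot\|$. The numerical radius is $w(T)=\sup\{|\langle Tx,x\rangle|:\|x\|=1\}$, and $w^r(T)=w(T)^r$. "Positive" means positive semidefinite; powers of positive operators are given by functional calculus, with zeroth power $I$. $\lfloor\cdot\rfloor$ is the greatest integer function, $\mathbb{N}=\{1,2,\dots\}$, and $0^0=1$. When $\nu=1$ all the coefficients in $\eta$ are $0$ and $\eta$ is understood to be $0$. *)

theory Defs
  imports "HOL-Analysis.Analysis" "HOL-Computational_Algebra.Polynomial"
begin

text \<open>
  A complex Hilbert space.  The real normed structure underlying it is the one of class
  \<open>banach\<close>, so that the library's metric notions and the type of bounded linear maps apply.
  The inner product is linear in its first argument.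
\<close>

class complex_hilbert_space = banach +
  fixes scaleC :: "complex \<Rightarrow> 'a \<Rightarrow> 'a" (infixr \<open>*\<^sub>C\<close> 75)
    and cinner :: "'a \<Rightarrow> 'a \<Rightarrow> complex"
  assumes scaleC_add_right: "c *\<^sub>C (x + y) = c *\<^sub>C x + c *\<^sub>C y"
    and scaleC_add_left: "(c + d) *\<^sub>C x = c *\<^sub>C x + d *\<^sub>C x"
    and scaleC_scaleC: "c *\<^sub>C d *\<^sub>C x = (c * d) *\<^sub>C x"
    and scaleC_of_real: "complex_of_real a *\<^sub>C x = a *\<^sub>R x"
    and cinner_commute: "cinner x y = cnj (cinner y x)"
    and cinner_add_left: "cinner (x + y) z = cinner x z + cinner y z"
    and cinner_scaleC_left: "cinner (c *\<^sub>C x) y = c * cinner x y"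
    and cinner_self_nonneg: "0 \<le> Re (cinner x x)"
    and cinner_self_eq_zero: "cinner x x = 0 \<Longrightarrow> x = 0"
    and norm_eq_sqrt_cinner: "norm x = sqrt (Re (cinner x x))"

text \<open>
  The algebra of bounded complex-linear operators, as a subset of the bounded real-linear ones.
  The norm of the ambient type is the operator norm.
\<close>

definition bounded_ops :: "('a::complex_hilbert_space \<Rightarrow>\<^sub>L 'a) set" where
  "bounded_ops = {T :: 'a \<Rightarrow>\<^sub>L 'a. \<forall>c x. T (c *\<^sub>C x) = c *\<^sub>C T x}"

definition positive_op :: "('a::complex_hilbert_space \<Rightarrow>\<^sub>L 'a) \<Rightarrow> bool" where
  "positive_op T \<longleftrightarrow> T \<in> bounded_ops \<and> (\<forall>x. cinner (T x) x \<in> \<real> \<and> 0 \<le> Re (cinner (T x) x))"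

text \<open>
  The supremum is taken in the nonnegative reals: inserting \<open>0\<close> only matters for the zero space,
  which has no unit vectors.
\<close>

definition numerical_radius :: "('a::complex_hilbert_space \<Rightarrow>\<^sub>L 'a) \<Rightarrow> real" where
  "numerical_radius T = Sup (insert 0 {cmod (cinner (T x) x) | x. norm x = 1})"

definition spectrum :: "('a::complex_hilbert_space \<Rightarrow>\<^sub>L 'a) \<Rightarrow> complex set" where
  "spectrum T = {z. \<not> (\<exists>S\<in>bounded_ops. \<forall>x. S (T x - z *\<^sub>C x) = x \<and> T (S x) - z *\<^sub>C S x = x)}"

definition poly_op :: "real poly \<Rightarrow> ('a::complex_hilbert_space \<Rightarrow>\<^sub>L 'a) \<Rightarrow> ('a \<Rightarrow>\<^sub>L 'a)" where
  "poly_op p T = (\<Sum>i\<le>degree p. coeff p i *\<^sub>R ((\<lambda>S. T o\<^sub>L S) ^^ i) id_blinfun)"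

text \<open>
  Continuous functional calculus for a self-adjoint operator \<open>T\<close> (whose spectrum is real) and a
  real function \<open>f\<close> continuous on the spectrum: the limit in operator norm of \<open>p\<^sub>n(T)\<close> for
  polynomials \<open>p\<^sub>n\<close> converging to \<open>f\<close> uniformly on the spectrum.
\<close>

definition fun_calc :: "(real \<Rightarrow> real) \<Rightarrow> ('a::complex_hilbert_space \<Rightarrow>\<^sub>L 'a) \<Rightarrow> ('a \<Rightarrow>\<^sub>L 'a)" where
  "fun_calc f T = (THE S. \<exists>p :: nat \<Rightarrow> real poly.
     uniform_limit {t. complex_of_real t \<in> spectrum T} (\<lambda>n. poly (p n)) f sequentially \<and>
     (\<lambda>n. poly_op (p n) T) \<longlonglongrightarrow> S)"

text \<open>The case distinction makes the zeroth power the identity, as \<open>0 powr 0 = 0\<close> in HOL.\<close>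

definition op_powr :: "('a::complex_hilbert_space \<Rightarrow>\<^sub>L 'a) \<Rightarrow> real \<Rightarrow> ('a \<Rightarrow>\<^sub>L 'a)" where
  "op_powr T s = fun_calc (\<lambda>t. if s = 0 then 1 else t powr s) T"

text \<open>
  For \<open>\<nu> < 1\<close> the subtractions of naturals below do not truncate.  For \<open>\<nu> = 1\<close> the last exponent
  does, but then every coefficient, and hence \<open>\<eta>\<close>, is \<open>0\<close>.
  The inner products are real for positive operators; \<open>Re\<close> only changes the type.
\<close>

definition eta :: "real \<Rightarrow> real \<Rightarrow> nat \<Rightarrow> ('a::complex_hilbert_space \<Rightarrow>\<^sub>L 'a) \<Rightarrow> ('a \<Rightarrow>\<^sub>L 'a) \<Rightarrow> 'a \<Rightarrow> real" where
  "eta \<nu> r N A B x =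
    (let a = Re (cinner (op_powr A r x) x);
         b = Re (cinner (op_powr B r x) x)
     in \<Sum>j=1..N.
       (let rj = nat \<lfloor>2 ^ j * \<nu>\<rfloor>;
            kj = nat \<lfloor>2 ^ (j - 1) * \<nu>\<rfloor>
        in ((-1) ^ rj * 2 ^ (j - 1) * \<nu> + (-1) ^ (rj + 1) * of_int \<lfloor>(real rj + 1) / 2\<rfloor>) *
           (root (2 ^ j) (b ^ (2 ^ (j - 1) - kj) * a ^ kj) -
            root (2 ^ j) (a ^ (kj + 1) * b ^ (2 ^ (j - 1) - kj - 1)))\<^sup>2))"

end

theory Submission
  imports Defs "HOL-Computational_Algebra.Fundamental_Theorem_Algebra"
begin

text \<open>
  For a unit vector \<open>x\<close>, Cauchy--Schwarz bounds the modulus of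
  \<open>\<langle>A\<^sup>\<nu> X B\<^sup>1\<^sup>-\<^sup>\<nu> x, x\<rangle> = \<langle>X B\<^sup>1\<^sup>-\<^sup>\<nu> x, A\<^sup>\<nu> x\<rangle>\<close> by \<open>\<parallel>X\<parallel> \<parallel>B\<^sup>1\<^sup>-\<^sup>\<nu> x\<parallel> \<parallel>A\<^sup>\<nu> x\<parallel>\<close>, and McCarthy's inequality
  bounds the \<open>r\<close>-th powers of the two vector norms by \<open>b\<^sup>1\<^sup>-\<^sup>\<nu>\<close> and \<open>a\<^sup>\<nu>\<close>, where \<open>a = \<langle>A\<^sup>r x, x\<rangle>\<close> and
  \<open>b = \<langle>B\<^sup>r x, x\<rangle>\<close>.  The function \<open>t \<mapsto> a\<^sup>t b\<^sup>1\<^sup>-\<^sup>t\<close> is convex, so it lies below its piecewise linear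
  interpolant at the multiples of \<open>2\<^sup>-\<^sup>N\<close>; that interpolant at \<open>\<nu>\<close> is exactly
  \<open>\<nu> a + (1 - \<nu>) b - \<eta>(x)\<close>, because each bisection of the mesh removes one term of \<open>\<eta>\<close>.
  The functional calculus rests on the bound of \<open>\<parallel>p(T)\<parallel>\<close> by the supremum of \<open>\<bar>p\<bar>\<close> over the real
  spectrum: a real polynomial without zeros in the spectrum of a self-adjoint \<open>T\<close> splits into
  linear and quadratic factors that are bounded below at \<open>T\<close>, whereas \<open>p(T)\<^sup>2 - \<parallel>p(T)\<parallel>\<^sup>2\<close> is not
  bounded below.
\<close>

subsection \<open>The inner product\<close>

lemma cinner_add_right: "cinner x (y + z) = cinner x y + cinner x z"
  by (metis cinner_commute cinner_add_left complex_cnj_add)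

lemma cinner_scaleC_right: "cinner x (c *\<^sub>C y) = cnj c * cinner x y"
  by (metis cinner_commute cinner_scaleC_left complex_cnj_mult)

lemma cinner_scaleR_left: "cinner (a *\<^sub>R x) y = of_real a * cinner x y"
  by (metis scaleC_of_real cinner_scaleC_left)

lemma cinner_diff_left: "cinner (x - y) z = cinner x z - cinner y z"
  using cinner_add_left[of "x - y" y z] by simp

lemma cinner_diff_right: "cinner x (y - z) = cinner x y - cinner x z"
  using cinner_add_right[of x "y - z" z] by simp

lemma cinner_self: "cinner x x = of_real ((norm x)\<^sup>2)"
proof (rule complex_eqI)
  show "Re (cinner x x) = Re (of_real ((norm x)\<^sup>2))"
    by (simp add: norm_eq_sqrt_cinner cinner_self_nonneg)
  show "Im (cinner x x) = Im (of_real ((norm x)\<^sup>2))"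
    using arg_cong[OF cinner_commute[of x x], of Im] by simp
qed

lemma norm_diff_scaleC_sq:
  "(norm (x - c *\<^sub>C y))\<^sup>2 = (norm x)\<^sup>2 - 2 * Re (cnj c * cinner x y) + (cmod c)\<^sup>2 * (norm y)\<^sup>2"
proof -
  have "complex_of_real ((norm (x - c *\<^sub>C y))\<^sup>2)
      = cinner x x - (cnj c * cinner x y + cnj (cnj c * cinner x y)) + c * cnj c * cinner y y"
    unfolding cinner_self[symmetric] using cinner_commute[of y x]
    by (simp add: cinner_diff_left cinner_diff_right cinner_scaleC_left
        cinner_scaleC_right algebra_simps)
  also have "\<dots> = complex_of_real ((norm x)\<^sup>2 - 2 * Re (cnj c * cinner x y) + (cmod c)\<^sup>2 * (norm y)\<^sup>2)"
    by (simp add: cinner_self complex_add_cnj complex_norm_square[symmetric] del: Re_complex_of_real complex_cnj_mult)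
  finally show ?thesis
    using of_real_eq_iff by blast
qed

lemma Cauchy_Schwarz_cinner: "cmod (cinner x y) \<le> norm x * norm y"
proof (cases "y = 0")
  case True
  then show ?thesis using cinner_diff_right[of x 0 0] by simp
next
  case False
  \<comment> \<open>The coefficient of the orthogonal projection of \<open>x\<close> onto the line
    of \<open>y\<close>; it minimises \<open>norm (x - c *\<^sub>C y)\<close>.\<close>
  define c where "c = cinner x y / of_real ((norm y)\<^sup>2)"
  have "cnj c * cinner x y = of_real ((cmod (cinner x y))\<^sup>2 / (norm y)\<^sup>2)"
    unfolding c_def using complex_norm_square[of "cinner x y"] by (simp add: mult.commute)
  moreover have "(cmod c)\<^sup>2 * (norm y)\<^sup>2 = (cmod (cinner x y))\<^sup>2 / (norm y)\<^sup>2"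
    using False unfolding c_def by (simp add: norm_divide norm_power power_divide field_simps)
  ultimately have "0 \<le> (norm x)\<^sup>2 - (cmod (cinner x y))\<^sup>2 / (norm y)\<^sup>2"
    using norm_diff_scaleC_sq[of x c y] zero_le_power2[of "norm (x - c *\<^sub>C y)"] by simp
  then have "(cmod (cinner x y))\<^sup>2 \<le> (norm x * norm y)\<^sup>2"
    using False by (simp add: field_simps)
  then show ?thesis
    by (rule power2_le_imp_le) simp
qed

interpretation cinner: bounded_bilinear "cinner :: 'a::complex_hilbert_space \<Rightarrow> 'a \<Rightarrow> complex"
proof
  show "\<exists>K. \<forall>a b::'a. cmod (cinner a b) \<le> norm a * norm b * K"
    by (rule exI[of _ 1]) (simp add: Cauchy_Schwarz_cinner)
  show "cinner x (a *\<^sub>R y) = a *\<^sub>R cinner x y" for x y :: 'a and a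
    by (metis scaleC_of_real cinner_scaleC_right complex_cnj_complex_of_real scaleR_conv_of_real)
qed (simp_all add: cinner_add_left cinner_add_right cinner_scaleR_left scaleR_conv_of_real)

lemma norm_diff_scaleR_sq:
  fixes x y :: "'a::complex_hilbert_space"
  shows "(norm (x - a *\<^sub>R y))\<^sup>2 = (norm x)\<^sup>2 - 2 * a * Re (cinner x y) + a\<^sup>2 * (norm y)\<^sup>2"
  using norm_diff_scaleC_sq[of x "of_real a" y] by (simp add: scaleC_of_real)

subsection \<open>Self-adjoint and positive operators\<close>

definition selfadjoint_op :: "('a::complex_hilbert_space \<Rightarrow>\<^sub>L 'a) \<Rightarrow> bool" where
  "selfadjoint_op T \<longleftrightarrow> T \<in> bounded_ops \<and> (\<forall>x y. cinner (T x) y = cinner x (T y))"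

lemma bounded_opsD: "T \<in> bounded_ops \<Longrightarrow> T (c *\<^sub>C x) = c *\<^sub>C T x"
  by (simp add: bounded_ops_def)

lemma selfadjointD: "selfadjoint_op T \<Longrightarrow> cinner (T x) y = cinner x (T y)"
  by (simp add: selfadjoint_op_def)

lemma selfadjoint_real: "selfadjoint_op T \<Longrightarrow> cinner (T x) x \<in> \<real>"
  by (metis cinner_commute selfadjointD Reals_cnj_iff)

text \<open>On a complex space a real quadratic form forces symmetry, by polarization; this yields
  the self-adjointness that \<open>positive_op\<close> does not state.\<close>

lemma positive_op_iff:
  "positive_op T \<longleftrightarrow> selfadjoint_op T \<and> (\<forall>x. 0 \<le> Re (cinner (T x) x))"
proof
  assume T: "positive_op T"
  then have lin: "T (c *\<^sub>C x) = c *\<^sub>C T x" and Im: "Im (cinner (T x) x) = 0" for c x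
    by (auto simp: positive_op_def bounded_ops_def complex_is_Real_iff)
  \<comment> \<open>In the form at \<open>x + \<i> *\<^sub>C y\<close> the cross terms contribute
    \<open>Re (cinner (T y) x) - Re (cinner (T x) y)\<close> to the imaginary part.\<close>
  have Re: "Re (cinner (T x) y) = Re (cinner x (T y))" for x y
    using Im[of "x + \<i> *\<^sub>C y"] Im[of x] Im[of y] arg_cong[OF cinner_commute[of "T y" x], of Re]
    by (simp add: blinfun.add_right lin cinner.add_left cinner.add_right cinner_scaleC_left
        cinner_scaleC_right)
  \<comment> \<open>Multiplying the second argument by \<open>\<i>\<close> turns imaginary parts
    into real parts.\<close>
  have "Im (cinner (T x) y) = Im (cinner x (T y))" for x y
    using Re[of x "\<i> *\<^sub>C y"] by (simp add: lin cinner_scaleC_right)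
  with Re T show "selfadjoint_op T \<and> (\<forall>x. 0 \<le> Re (cinner (T x) x))"
    by (auto simp: positive_op_def selfadjoint_op_def intro: complex_eqI)
qed (auto simp: positive_op_def selfadjoint_real, simp add: selfadjoint_op_def)

section \<open>Closure of the self-adjoint operators under algebra and limits\<close>

lemma selfadjoint_zero: "selfadjoint_op 0"
  by (simp add: selfadjoint_op_def bounded_ops_def cinner.zero_left cinner.zero_right)
     (metis scaleC_of_real scaleC_scaleC mult.commute of_real_0 scaleR_zero_left mult_zero_left)

lemma selfadjoint_id: "selfadjoint_op id_blinfun"
  by (simp add: selfadjoint_op_def bounded_ops_def)

lemma selfadjoint_add: "selfadjoint_op S \<Longrightarrow> selfadjoint_op T \<Longrightarrow> selfadjoint_op (S + T)"
  by (simp add: selfadjoint_op_def bounded_ops_def blinfun.add_left scaleC_add_right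
      cinner.add_left cinner.add_right)

lemma bounded_ops_scaleR: "T \<in> bounded_ops \<Longrightarrow> a *\<^sub>R T \<in> bounded_ops"
  unfolding bounded_ops_def scaleC_of_real[symmetric]
  by (simp add: blinfun.scaleR_left scaleC_of_real[symmetric] scaleC_scaleC mult.commute)

lemma selfadjoint_scaleR: "selfadjoint_op T \<Longrightarrow> selfadjoint_op (a *\<^sub>R T)"
  by (simp add: selfadjoint_op_def bounded_ops_scaleR blinfun.scaleR_left
      cinner.scaleR_left cinner.scaleR_right)

lemma selfadjoint_compose:
  assumes "selfadjoint_op S" "selfadjoint_op T" "S o\<^sub>L T = T o\<^sub>L S"
  shows "selfadjoint_op (S o\<^sub>L T)"
proof -
  have "cinner (S (T x)) y = cinner x (S (T y))" for x y
    using assms(3) by (metis assms(1,2) selfadjointD blinfun_apply_blinfun_compose)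
  then show ?thesis
    using assms by (simp add: selfadjoint_op_def bounded_ops_def)
qed

lemma norm_scaleC: "norm (c *\<^sub>C x) = cmod c * norm x"
proof (rule power2_eq_imp_eq)
  have "complex_of_real ((norm (c *\<^sub>C x))\<^sup>2) = c * cnj c * cinner x x"
    unfolding cinner_self[symmetric] by (simp add: cinner_scaleC_left cinner_scaleC_right)
  also have "\<dots> = complex_of_real ((cmod c * norm x)\<^sup>2)"
    by (simp add: cinner_self complex_norm_square[symmetric] power_mult_distrib)
  finally show "(norm (c *\<^sub>C x))\<^sup>2 = (cmod c * norm x)\<^sup>2"
    using of_real_eq_iff by blast
qed simp_all

lemma bounded_linear_scaleC: "bounded_linear (\<lambda>x::'a::complex_hilbert_space. c *\<^sub>C x)"
proof (rule bounded_linear_intro[of _ "cmod c"])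
  show "c *\<^sub>C (r *\<^sub>R x) = r *\<^sub>R (c *\<^sub>C x)" for r and x :: 'a
    unfolding scaleC_of_real[symmetric] by (simp add: scaleC_scaleC mult.commute)
qed (simp_all add: scaleC_add_right norm_scaleC mult.commute)

lemma selfadjoint_lim:
  assumes T: "\<And>n. selfadjoint_op (T n)" and lim: "T \<longlonglongrightarrow> S"
  shows "selfadjoint_op S"
proof -
  have ap: "(\<lambda>n. T n x) \<longlonglongrightarrow> S x" for x
    by (intro tendsto_intros lim)
  have "S (c *\<^sub>C x) = c *\<^sub>C S x" for c x
  proof (rule LIMSEQ_unique[OF ap])
    have "(\<lambda>n. c *\<^sub>C T n x) \<longlonglongrightarrow> c *\<^sub>C S x"
      by (rule bounded_linear.tendsto[OF bounded_linear_scaleC ap])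
    moreover have "c *\<^sub>C T n x = T n (c *\<^sub>C x)" for n
      using T by (simp add: selfadjoint_op_def bounded_ops_def)
    ultimately show "(\<lambda>n. T n (c *\<^sub>C x)) \<longlonglongrightarrow> c *\<^sub>C S x"
      by simp
  qed
  moreover have "cinner (S x) y = cinner x (S y)" for x y
  proof (rule LIMSEQ_unique)
    show "(\<lambda>n. cinner (T n x) y) \<longlonglongrightarrow> cinner (S x) y"
      by (intro cinner.tendsto ap tendsto_const)
    show "(\<lambda>n. cinner (T n x) y) \<longlonglongrightarrow> cinner x (S y)"
      unfolding selfadjointD[OF T] by (intro cinner.tendsto ap tendsto_const)
  qed
  ultimately show ?thesis
    by (simp add: selfadjoint_op_def bounded_ops_def)
qed

text \<open>This is \<open>T\<^sup>2 \<le> norm T * T\<close> in form notation. It comes from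
  nonnegativity of the form of \<open>T\<close> at \<open>x - (1/M) *\<^sub>R T x\<close>, where
  \<open>M = norm T\<close>.\<close>

lemma positive_norm_sq_le:
  fixes T :: "'a::complex_hilbert_space \<Rightarrow>\<^sub>L 'a"
  assumes "positive_op T"
  shows "(norm (T x))\<^sup>2 \<le> norm T * Re (cinner (T x) x)"
proof (cases "norm T = 0")
  case True
  then show ?thesis by simp
next
  case False
  define M where "M = norm T"
  have M: "M > 0" using False by (simp add: M_def)
  define y where "y = T x"
  have T: "selfadjoint_op T" and pos: "\<And>z. 0 \<le> Re (cinner (T z) z)"
    using assms by (auto simp: positive_op_iff)
  have "cinner (T y) x = cinner y y"
    by (simp add: y_def selfadjointD[OF T])
  then have "Re (cinner (T (x - (1/M) *\<^sub>R y)) (x - (1/M) *\<^sub>R y))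
     = Re (cinner y x) - 2 / M * (norm y)\<^sup>2 + (1/M)\<^sup>2 * Re (cinner (T y) y)"
    unfolding blinfun.diff_right blinfun.scaleR_right cinner.diff_left cinner.diff_right
      cinner.scaleR_left cinner.scaleR_right y_def[symmetric]
    by (simp add: cinner_self power2_eq_square algebra_simps)
  moreover have "Re (cinner (T y) y) \<le> M * (norm y)\<^sup>2"
  proof -
    have "Re (cinner (T y) y) \<le> norm (T y) * norm y"
      using Cauchy_Schwarz_cinner complex_Re_le_cmod order_trans by blast
    also have "\<dots> \<le> (M * norm y) * norm y"
      unfolding M_def by (intro mult_right_mono norm_blinfun) simp
    finally show ?thesis by (simp add: power2_eq_square)
  qed
  then have "(1/M)\<^sup>2 * Re (cinner (T y) y) \<le> (1/M)\<^sup>2 * (M * (norm y)\<^sup>2)"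
    by (rule mult_left_mono) simp
  ultimately have "0 \<le> Re (cinner y x) - 2 / M * (norm y)\<^sup>2 + (1/M)\<^sup>2 * (M * (norm y)\<^sup>2)"
    using pos[of "x - (1/M) *\<^sub>R y"] by linarith
  also have "\<dots> = Re (cinner y x) - (norm y)\<^sup>2 / M"
    using M by (simp add: field_simps power2_eq_square)
  finally show ?thesis
    using M unfolding y_def[symmetric] M_def[symmetric] by (simp add: field_simps)
qed

subsection \<open>The spectrum of a positive operator\<close>

text \<open>The inverse of \<open>I - K\<close> sends \<open>y\<close> to the unique Banach fixed
  point of \<open>x \<mapsto> y + K x\<close>. Uniqueness makes this map linear, and the contraction
  estimate bounds it by \<open>1 / (1 - c)\<close>.\<close>

lemma ex_inverse_of_contraction:
  fixes K :: "'a::complex_hilbert_space \<Rightarrow>\<^sub>L 'a"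
  assumes K: "K \<in> bounded_ops" and c: "0 \<le> c" "c < 1" "\<And>x. norm (K x) \<le> c * norm x"
  shows "\<exists>S\<in>bounded_ops. \<forall>x. S (x - K x) = x \<and> S x - K (S x) = x"
proof -
  have "\<exists>!x. x \<in> UNIV \<and> y + K x = x" for y
    using c by (intro Banach_fix[of UNIV c]) 
       (auto simp: complete_UNIV dist_norm blinfun.diff_right[symmetric])
  then obtain s where s: "\<And>y. y + K (s y) = s y" and u: "\<And>y x. y + K x = x \<Longrightarrow> x = s y"
    by simp metis
  have add: "s (x + y) = s x + s y" for x y
    by (rule u[symmetric]) (metis s add.assoc add.left_commute blinfun.add_right)
  have scC: "s (a *\<^sub>C x) = a *\<^sub>C s x" for a x
    by (rule u[symmetric]) (metis s bounded_opsD[OF K] scaleC_add_right)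
  have scR: "s (a *\<^sub>R x) = a *\<^sub>R s x" for a x
    by (metis scC scaleC_of_real)
  have nrm: "norm (s x) \<le> norm x * (1 / (1 - c))" for x
  proof -
    have "norm (s x) \<le> norm x + c * norm (s x)"
      by (metis s norm_triangle_le add_left_mono c(3) order_refl)
    then show ?thesis using c by (simp add: field_simps)
  qed
  have ap: "blinfun_apply (Blinfun s) = s"
    by (intro bounded_linear_Blinfun_apply bounded_linear_intro[of _ "1 / (1 - c)"] add scR nrm)
  have "s (x - K x) = x" for x
    by (rule u[symmetric]) simp
  moreover have "s x - K (s x) = x" for x
    by (metis s add_diff_cancel_right')
  ultimately show ?thesis
    using scC by (intro bexI[of _ "Blinfun s"]) (auto simp: ap bounded_ops_def)
qed

lemma positive_op_spectrum:
  fixes T :: "'a::complex_hilbert_space \<Rightarrow>\<^sub>L 'a"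
  assumes T: "positive_op T" and t: "complex_of_real t \<in> spectrum T"
  shows "t \<in> {0..norm T}"
proof (rule ccontr)
  assume nt: "t \<notin> {0..norm T}"
  \<comment> \<open>The midpoint of \<open>{0..norm T}\<close>: \<open>T - m\<close> has norm at
    most \<open>m\<close>, and \<open>\<bar>t - m\<bar> > m\<close>. Hence \<open>K\<close> is a
    strict contraction, and \<open>T - t = (m - t)(I - K)\<close> is invertible.\<close>
  define m where "m = norm T / 2"
  define K where "K = (1 / (t - m)) *\<^sub>R (T - m *\<^sub>R id_blinfun)"
  have sT: "selfadjoint_op T" using T by (simp add: positive_op_iff)
  have tm: "\<bar>t - m\<bar> > m" "m \<ge> 0" "t \<noteq> m"
    using nt norm_ge_zero[of T] by (auto simp: m_def abs_if simp del: norm_ge_zero)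
  have "selfadjoint_op K"
  proof -
    have "K = (1 / (t - m)) *\<^sub>R (T + (- m) *\<^sub>R id_blinfun)" by (simp add: K_def)
    then show ?thesis
      by (simp only: selfadjoint_scaleR selfadjoint_add sT selfadjoint_id)
  qed
  then have K: "K \<in> bounded_ops" by (simp add: selfadjoint_op_def)
  \<comment> \<open>In the expanded square,
    \<open>(norm (T x))\<^sup>2 - 2 * m * Re (cinner (T x) x)\<close> is at most 0 because
    \<open>2 * m = norm T\<close>.\<close>
  have bd: "norm (T x - m *\<^sub>R x) \<le> m * norm x" for x
  proof (rule power2_le_imp_le)
    show "(norm (T x - m *\<^sub>R x))\<^sup>2 \<le> (m * norm x)\<^sup>2"
      using norm_diff_scaleR_sq[of "T x" m x] positive_norm_sq_le[OF T, of x]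
      by (simp add: m_def power2_eq_square)
  qed (use tm in simp)
  have "norm (K x) \<le> m / \<bar>t - m\<bar> * norm x" for x
    using bd[of x] tm
    by (simp add: K_def blinfun.scaleR_left blinfun.diff_left divide_right_mono)
  from ex_inverse_of_contraction[OF K _ _ this] tm
  obtain S where S: "S \<in> bounded_ops" and S': "\<And>x. S (x - K x) = x" "\<And>x. S x - K (S x) = x"
    by (auto simp: field_simps)
  define u where "u = m - t"
  have u: "u \<noteq> 0" using tm(3) by (simp add: u_def)
  define R where "R = (1 / u) *\<^sub>R S"
  have Rb: "R \<in> bounded_ops"
    using S by (simp add: R_def bounded_ops_scaleR)
  have key: "T x - t *\<^sub>R x = u *\<^sub>R (x - K x)" for x
  proof -
    have "u *\<^sub>R K x = - (T x - m *\<^sub>R x)"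
    proof -
      have "u * (1 / (t - m)) = - 1"
        using tm(3) by (simp add: u_def field_simps)
      then show ?thesis
        unfolding K_def blinfun.scaleR_left blinfun.diff_left scaleR_scaleR by simp
    qed
    then show ?thesis
      by (simp add: scaleR_diff_right u_def scaleR_diff_left)
  qed
  have "R (T x - t *\<^sub>R x) = x" for x
    using u by (simp add: key R_def blinfun.scaleR_left blinfun.scaleR_right S'(1))
  moreover have "T (R x) - t *\<^sub>R R x = x" for x
  proof -
    have "R x - K (R x) = (1 / u) *\<^sub>R x"
      by (metis R_def S'(2) blinfun.scaleR_left blinfun.scaleR_right scaleR_diff_right)
    then show ?thesis
      using u by (simp add: key)
  qed
  ultimately have "complex_of_real t \<notin> spectrum T"
    using Rb unfolding spectrum_def by (auto simp: scaleC_of_real)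
  with t show False by simp
qed

subsection \<open>Polynomials of a self-adjoint operator\<close>

lemma poly_op_0: "poly_op 0 T = 0"
  by (simp add: poly_op_def)

lemma poly_op_bound:
  "degree p \<le> n \<Longrightarrow> poly_op p T = (\<Sum>i\<le>n. coeff p i *\<^sub>R ((\<lambda>S. T o\<^sub>L S) ^^ i) id_blinfun)"
  unfolding poly_op_def by (rule sum.mono_neutral_left) (auto simp: coeff_eq_0)

text \<open>Horner's rule, which carries the inductions over polynomials.\<close>

lemma poly_op_pCons: "poly_op (pCons a p) T = a *\<^sub>R id_blinfun + (T o\<^sub>L poly_op p T)"
proof -
  have "degree (pCons a p) \<le> Suc (degree p)"
    by (simp add: degree_pCons_le)
  then have "poly_op (pCons a p) T = a *\<^sub>R id_blinfun
      + (\<Sum>i\<le>degree p. coeff p i *\<^sub>R (T o\<^sub>L ((\<lambda>S. T o\<^sub>L S) ^^ i) id_blinfun))"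
    unfolding poly_op_bound[OF \<open>degree (pCons a p) \<le> Suc (degree p)\<close>] by (simp add: sum.atMost_Suc_shift del: sum.atMost_Suc)
  also have "(\<Sum>i\<le>degree p. coeff p i *\<^sub>R (T o\<^sub>L ((\<lambda>S. T o\<^sub>L S) ^^ i) id_blinfun)) = T o\<^sub>L poly_op p T"
    unfolding poly_op_def
    by (simp add: bounded_bilinear.sum_right[OF bounded_bilinear_blinfun_compose]
        bounded_bilinear.scaleR_right[OF bounded_bilinear_blinfun_compose])
  finally show ?thesis .
qed

lemma poly_op_pCons_apply: "poly_op (pCons a p) T x = a *\<^sub>R x + T (poly_op p T x)"
  by (simp add: poly_op_pCons blinfun.add_left blinfun.scaleR_left)

lemma poly_op_const: "poly_op [:c:] T = c *\<^sub>R id_blinfun"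
  by (simp add: poly_op_pCons poly_op_0)

lemma poly_op_add: "poly_op (p + q) T = poly_op p T + poly_op q T"
  by (induction p q rule: poly_induct2)
     (auto simp: poly_op_0 poly_op_pCons_apply blinfun.add_left blinfun.add_right scaleR_add_left
       intro: blinfun_eqI)

lemma poly_op_smult: "poly_op (smult c p) T = c *\<^sub>R poly_op p T"
  by (induction p)
     (auto simp: poly_op_0 poly_op_pCons_apply blinfun.scaleR_left blinfun.scaleR_right
       scaleR_add_right intro: blinfun_eqI)

lemma poly_op_diff: "poly_op (p - q) T = poly_op p T - poly_op q T"
  using poly_op_add[of "p - q" q T] by simp

lemma poly_op_mult: "poly_op (p * q) T = poly_op p T o\<^sub>L poly_op q T"
proof (induction p)
  case 0
  then show ?case by (simp add: poly_op_0)
next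
  case (pCons a p)
  show ?case
    by (rule blinfun_eqI)
       (simp add: poly_op_add poly_op_smult poly_op_pCons_apply pCons.IH blinfun.add_left
         blinfun.scaleR_left)
qed

lemma selfadjoint_poly_op:
  assumes "selfadjoint_op T"
  shows "selfadjoint_op (poly_op p T)"
proof (induction p)
  case 0
  show ?case by (simp add: poly_op_0 selfadjoint_zero)
next
  case (pCons a p)
  \<comment> \<open>Seen as a polynomial in itself, \<open>T\<close> commutes with
    \<open>p(T)\<close> because polynomial multiplication is commutative.\<close>
  have "T = poly_op [:0, 1:] T"
    by (rule blinfun_eqI) (simp add: poly_op_pCons_apply poly_op_0)
  then have "T o\<^sub>L poly_op p T = poly_op p T o\<^sub>L T"
    by (metis poly_op_mult mult.commute)
  then show ?case
    unfolding poly_op_pCons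
    by (intro selfadjoint_add selfadjoint_scaleR selfadjoint_id selfadjoint_compose assms pCons.IH)
qed

section \<open>Real factorisation, lower bounds and the norm estimate over the spectrum\<close>

lemma real_poly_root_cases:
  fixes q :: "real poly"
  assumes "degree q > 0"
  obtains (linear) t q' where "q = [:- t, 1:] * q'"
  | (quadratic) a b q' where "b \<noteq> 0" "q = [:a\<^sup>2 + b\<^sup>2, - 2 * a, 1:] * q'"
proof -
  define C where "C = map_poly complex_of_real"
  have C: "C (p + r) = C p + C r" "C (p * r) = C p * C r" for p r
    unfolding C_def
    by (auto intro!: poly_eqI simp: coeff_map_poly coeff_mult)
  have Cp: "poly (C [:x, y:]) z = of_real x + z * of_real y" for x y z
    by (simp add: C_def map_poly_pCons)
  have "degree (C q) > 0"
    using assms by (simp add: C_def degree_map_poly)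
  then have "\<not> constant (poly (C q))"
    by (simp add: constant_degree)
  then obtain z where z: "poly (C q) z = 0"
    using fundamental_theorem_of_algebra by blast
  show thesis
  proof (cases "Im z = 0")
    case True
    then have "z = of_real (Re z)" by (simp add: complex_eq_iff)
    moreover have "poly (C q) (of_real t) = of_real (poly q t)" for t
      by (induction q) (simp_all add: C_def map_poly_pCons)
    ultimately have "poly q (Re z) = 0"
      using z by (metis of_real_eq_0_iff)
    then show thesis
      using linear by (auto simp: poly_eq_0_iff_dvd elim: dvdE)
  next
    case False
    \<comment> \<open>The real quadratic with roots \<open>z\<close> and \<open>cnj z\<close>. The
      remainder of \<open>q\<close> modulo \<open>m\<close> is a real polynomial of degree at most 1
      vanishing at the non-real \<open>z\<close>, so it is zero.\<close>
    define m where "m = [:(Re z)\<^sup>2 + (Im z)\<^sup>2, - 2 * Re z, 1:]"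
    have "poly (C m) z = 0"
      by (simp add: C_def m_def map_poly_pCons complex_eq_iff power2_eq_square algebra_simps)
    then have r0: "poly (C (q mod m)) z = 0"
      using z by (metis C div_mult_mod_eq poly_add poly_mult mult_zero_right add_0)
    have "degree m = 2" by (simp add: m_def)
    then have "m \<noteq> 0" by auto
    with \<open>degree m = 2\<close> have "q mod m = 0 \<or> degree (q mod m) < 2"
      using degree_mod_less[of m q] by auto
    then have "q mod m = [:coeff (q mod m) 0, coeff (q mod m) 1:]"
      by (auto intro!: poly_eqI simp: coeff_pCons coeff_eq_0 split: nat.split)
    with r0 have "of_real (coeff (q mod m) 0) + z * of_real (coeff (q mod m) 1) = 0"
      by (metis Cp)
    then have "coeff (q mod m) 1 = 0" "coeff (q mod m) 0 = 0"
      using False by (auto simp: complex_eq_iff)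
    with \<open>q mod m = _\<close> have "q mod m = 0" by simp
    then show thesis
      using quadratic[of "Im z" "Re z" "q div m"] False div_mult_mod_eq[of q m]
      by (simp add: m_def mult.commute)
  qed
qed

text \<open>Induction on the degree, splitting off one real factor at a time. A linear factor has
  its root off the spectrum, so a resolvent bounds it below; a quadratic factor is
  \<open>(T - a)\<^sup>2 + b\<^sup>2\<close>, bounded below by \<open>b\<^sup>2\<close>.\<close>

lemma poly_op_bounded_below:
  fixes T :: "'a::complex_hilbert_space \<Rightarrow>\<^sub>L 'a"
  assumes T: "selfadjoint_op T" and "q \<noteq> 0"
    and "\<And>t. complex_of_real t \<in> spectrum T \<Longrightarrow> poly q t \<noteq> 0"
  shows "\<exists>c>0. \<forall>x. c * norm x \<le> norm (poly_op q T x)"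
  using assms(2,3)
proof (induction "degree q" arbitrary: q rule: less_induct)
  case less
  \<comment> \<open>Lower bounds of two factors multiply, since
    \<open>q(T) x = p(T) (q'(T) x)\<close>.\<close>
  have step: "\<exists>c>0. \<forall>x. c * norm x \<le> norm (poly_op q T x)"
    if q: "q = p * q'" and p: "degree p > 0" and c: "c > 0" "\<And>x. c * norm x \<le> norm (poly_op p T x)"
    for p q' c
  proof -
    have "degree q' < degree q"
      using p less.prems(1) by (simp add: q degree_mult_eq)
    with less q obtain d where d: "d > 0" "\<And>x. d * norm x \<le> norm (poly_op q' T x)"
      by (metis mult_zero_right poly_mult)
    have "c * d * norm x \<le> norm (poly_op q T x)" for x
    proof -
      have "c * (d * norm x) \<le> c * norm (poly_op q' T x)"
        using c(1) d(2) by (intro mult_left_mono) auto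
      also have "\<dots> \<le> norm (poly_op q T x)"
        using c(2) by (simp add: q poly_op_mult)
      finally show ?thesis by (simp add: mult.assoc)
    qed
    with c(1) d(1) show ?thesis
      by (intro exI[of _ "c * d"]) simp
  qed
  show ?case
  proof (cases "degree q = 0")
    case True
    then obtain a where q: "q = [:a:]" by (rule degree_eq_zeroE)
    with less.prems(1) show ?thesis
      by (intro exI[of _ "\<bar>a\<bar>"]) (simp add: poly_op_const blinfun.scaleR_left)
  next
    case False
    then have "degree q > 0" by simp
    then show ?thesis
    proof (cases rule: real_poly_root_cases)
      case (linear t q')
      then have "poly q t = 0" by simp
      with less.prems(2) have "complex_of_real t \<notin> spectrum T" by blast
      then obtain S :: "'a \<Rightarrow>\<^sub>L 'a" where S: "\<And>x. S (T x - t *\<^sub>R x) = x"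
        by (auto simp: spectrum_def scaleC_of_real)
      \<comment> \<open>Adding 1 keeps the denominator positive even when
        \<open>norm S = 0\<close>.\<close>
      have "1 / (norm S + 1) * norm x \<le> norm (poly_op [:- t, 1:] T x)" for x
      proof -
        have "norm x \<le> norm S * norm (T x - t *\<^sub>R x)"
          by (metis S norm_blinfun)
        also have "\<dots> \<le> (norm S + 1) * norm (T x - t *\<^sub>R x)"
          by (intro mult_right_mono) auto
        finally show ?thesis
          by (simp add: poly_op_pCons_apply poly_op_0 field_simps add_pos_nonneg)
      qed
      with step[OF linear(1), of "1 / (norm S + 1)"] show ?thesis
        by (simp add: add_nonneg_pos)
    next
      case (quadratic a b q')
      have "b\<^sup>2 * norm x \<le> norm (poly_op [:a\<^sup>2 + b\<^sup>2, - 2 * a, 1:] T x)" for x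
      proof (cases "x = 0")
        case False
        define y where "y = poly_op [:a\<^sup>2 + b\<^sup>2, - 2 * a, 1:] T x"
        have y: "y = (a\<^sup>2 + b\<^sup>2) *\<^sub>R x - (2 * a) *\<^sub>R T x + T (T x)"
          by (simp add: y_def poly_op_pCons_apply poly_op_0 blinfun.add_right blinfun.scaleR_right
              blinfun.diff_right)
        have "Re (cinner y x) = (norm (T x - a *\<^sub>R x))\<^sup>2 + b\<^sup>2 * (norm x)\<^sup>2"
          unfolding y norm_diff_scaleR_sq
          by (simp add: cinner.add_left cinner.diff_left cinner.scaleR_left selfadjointD[OF T, of "T x"]
              cinner_self algebra_simps del: of_real_power)
        then have "b\<^sup>2 * (norm x)\<^sup>2 \<le> Re (cinner y x)" by simp
        also have "\<dots> \<le> norm y * norm x"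
          using Cauchy_Schwarz_cinner complex_Re_le_cmod order_trans by blast
        finally show ?thesis
          using False by (simp add: y_def power2_eq_square)
      qed simp
      with step[OF quadratic(2), of "b\<^sup>2"] quadratic(1) show ?thesis
        by simp
    qed
  qed
qed

text \<open>The zeros of \<open>q = p\<^sup>2 - n\<^sup>2\<close> are the points where
  \<open>\<bar>p\<bar> = n\<close>, with \<open>n = norm (p(T))\<close>. If none lay in the
  spectrum, \<open>q(T)\<close> would be bounded below, and \<open>p(T)\<close> would have norm
  below \<open>n\<close>. Positive degree keeps \<open>q\<close> from vanishing identically.\<close>

lemma ex_spectrum_norm_poly_op:
  fixes T :: "'a::complex_hilbert_space \<Rightarrow>\<^sub>L 'a"
  assumes T: "selfadjoint_op T" and p: "degree p > 0" and n: "norm (poly_op p T) > 0"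
  shows "\<exists>t. complex_of_real t \<in> spectrum T \<and> \<bar>poly p t\<bar> = norm (poly_op p T)"
proof (rule ccontr)
  assume *: "\<not> ?thesis"
  define S where "S = poly_op p T"
  define n where "n = norm S"
  define q where "q = p * p - [:n\<^sup>2:]"
  have n0: "n > 0" using n by (simp add: n_def S_def)
  have S: "selfadjoint_op S" by (simp add: S_def selfadjoint_poly_op T)
  have "degree (p * p) > 0"
    using p by (subst degree_mult_eq) auto
  then have "q \<noteq> 0"
    by (auto simp: q_def)
  moreover have "poly q t \<noteq> 0" if "complex_of_real t \<in> spectrum T" for t
  proof
    assume "poly q t = 0"
    then have "(poly p t)\<^sup>2 = n\<^sup>2" by (simp add: q_def power2_eq_square)
    then have "\<bar>poly p t\<bar> = n" using n0 by (metis abs_of_pos power2_eq_iff abs_minus_cancel)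
    with that * show False
      by (auto simp: n_def S_def)
  qed
  ultimately obtain c where c: "c > 0" "\<And>x. c * norm x \<le> norm (poly_op q T x)"
    using poly_op_bounded_below[OF T] by blast
  \<comment> \<open>Expanding the lower bound for \<open>S\<^sup>2 - n\<^sup>2\<close> and using
    \<open>norm (S (S x)) \<le> n * norm (S x)\<close> gives \<open>(norm (S x))\<^sup>2 \<le>
    (n\<^sup>2 - c\<^sup>2 / n\<^sup>2) * (norm x)\<^sup>2\<close>. The maximum with 0 makes the
    root usable before the sign is known.\<close>
  define k where "k = sqrt (max 0 (n\<^sup>2 - c\<^sup>2 / n\<^sup>2))"
  have k0: "0 \<le> k" and k2: "k\<^sup>2 = max 0 (n\<^sup>2 - c\<^sup>2 / n\<^sup>2)"
    by (simp_all add: k_def)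
  have "norm (S x) \<le> k * norm x" for x
  proof -
    have qx: "poly_op q T x = S (S x) - n\<^sup>2 *\<^sub>R x"
      by (simp add: q_def poly_op_diff poly_op_mult poly_op_const S_def blinfun.diff_left
          blinfun.scaleR_left)
    have "(c * norm x)\<^sup>2 \<le> (norm (S (S x) - n\<^sup>2 *\<^sub>R x))\<^sup>2"
      using c by (intro power_mono) (auto simp: qx[symmetric])
    also have "\<dots> = (norm (S (S x)))\<^sup>2 - 2 * n\<^sup>2 * (norm (S x))\<^sup>2 + n^4 * (norm x)\<^sup>2"
      unfolding norm_diff_scaleR_sq by (simp add: selfadjointD[OF S] cinner_self del: of_real_power)
    also have "\<dots> \<le> (n * norm (S x))\<^sup>2 - 2 * n\<^sup>2 * (norm (S x))\<^sup>2 + n^4 * (norm x)\<^sup>2"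
      by (intro add_right_mono diff_right_mono power_mono) (auto simp: n_def norm_blinfun)
    finally have le: "(c * norm x)\<^sup>2 \<le> (n * norm (S x))\<^sup>2 - 2 * n\<^sup>2 * (norm (S x))\<^sup>2 + n^4 * (norm x)\<^sup>2" .
    then have "n\<^sup>2 * (norm (S x))\<^sup>2 \<le> n\<^sup>2 * ((n\<^sup>2 - c\<^sup>2 / n\<^sup>2) * (norm x)\<^sup>2)"
    proof -
      have "n\<^sup>2 * ((n\<^sup>2 - c\<^sup>2 / n\<^sup>2) * (norm x)\<^sup>2) = n^4 * (norm x)\<^sup>2 - (c * norm x)\<^sup>2"
        using n0 by (simp add: field_simps power2_eq_square power4_eq_xxxx)
      with le show ?thesis by (simp add: power_mult_distrib)
    qed
    then have "(norm (S x))\<^sup>2 \<le> (n\<^sup>2 - c\<^sup>2 / n\<^sup>2) * (norm x)\<^sup>2"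
      using n0 by simp
    also have "\<dots> \<le> k\<^sup>2 * (norm x)\<^sup>2"
      unfolding k2 by (intro mult_right_mono) simp_all
    finally have "(norm (S x))\<^sup>2 \<le> (k * norm x)\<^sup>2"
      by (simp add: power_mult_distrib)
    then show ?thesis
      by (rule power2_le_imp_le) (simp add: k0)
  qed
  then have "n \<le> k"
    unfolding n_def by (intro norm_blinfun_bound k0)
  moreover have "k < n"
  proof (rule power2_less_imp_less)
    show "k\<^sup>2 < n\<^sup>2"
      unfolding k2 using n0 c(1) by simp
  qed (use n0 in simp)
  ultimately show False by simp
qed

lemma norm_poly_op_le:
  fixes T :: "'a::complex_hilbert_space \<Rightarrow>\<^sub>L 'a"
  assumes T: "selfadjoint_op T" and M: "0 \<le> M"
    and bd: "\<And>t. complex_of_real t \<in> spectrum T \<Longrightarrow> \<bar>poly p t\<bar> \<le> M"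
  shows "norm (poly_op p T) \<le> M"
proof (cases "norm (poly_op p T) > 0")
  case True
  show ?thesis
  proof (cases "degree p > 0")
    case True
    from ex_spectrum_norm_poly_op[OF T this \<open>norm (poly_op p T) > 0\<close>] bd show ?thesis
      by metis
  next
    case False
    then obtain c where c: "p = [:c:]" by (metis degree_eq_zeroE gr0I)
    \<comment> \<open>For constant \<open>p\<close> the bound says something only if the real
      spectrum is nonempty. Otherwise every \<open>s + T\<close> would be 0, so the identity would
      be 0 and the space trivial.\<close>
    have "\<exists>t. complex_of_real t \<in> spectrum T"
    proof (rule ccontr)
      assume "\<nexists>t. complex_of_real t \<in> spectrum T"
      then have zero: "norm (poly_op [:s, 1:] T) = 0" for s
        using ex_spectrum_norm_poly_op[OF T, of "[:s, 1:]"] by fastforce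
      have "s *\<^sub>R x + T x = 0" for s x
      proof -
        have "poly_op [:s, 1:] T x = 0"
          using zero[of s] by simp
        then show ?thesis by (simp add: poly_op_pCons_apply poly_op_0)
      qed
      from this[of 0] this[of 1] have "x = 0" for x :: 'a
        by simp
      then have "poly_op p T = 0" by (metis blinfun_eqI)
      with True show False by simp
    qed
    then have "\<bar>c\<bar> \<le> M" using bd by (auto simp: c)
    moreover have "norm (poly_op p T) \<le> \<bar>c\<bar>"
      by (rule norm_blinfun_bound) (auto simp: c poly_op_const blinfun.scaleR_left)
    ultimately show ?thesis by simp
  qed
qed (use M in simp)

subsection \<open>Functional calculus of a positive operator\<close>

lemma poly_op_tendsto_0:
  assumes "selfadjoint_op T"
    and lim: "uniform_limit {t. complex_of_real t \<in> spectrum T} (\<lambda>n. poly (p n)) (\<lambda>_. 0) F"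
  shows "((\<lambda>n. poly_op (p n) T) \<longlongrightarrow> 0) F"
proof (rule tendstoI)
  fix e :: real assume e: "e > 0"
  then have "\<forall>\<^sub>F n in F. \<forall>t\<in>{t. complex_of_real t \<in> spectrum T}. dist (poly (p n) t) 0 < e / 2"
    using uniform_limitD[OF lim, of "e / 2"] by simp
  then show "\<forall>\<^sub>F n in F. dist (poly_op (p n) T) 0 < e"
  proof eventually_elim
    case (elim n)
    then have "norm (poly_op (p n) T) \<le> e / 2"
      using e by (intro norm_poly_op_le assms(1)) (auto intro: less_imp_le)
    with e show ?case by simp
  qed
qed

lemma poly_op_convergent:
  fixes T :: "'a::complex_hilbert_space \<Rightarrow>\<^sub>L 'a"
  assumes T: "selfadjoint_op T"
    and lim: "uniform_limit {t. complex_of_real t \<in> spectrum T} (\<lambda>n. poly (p n)) f sequentially"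
  shows "convergent (\<lambda>n. poly_op (p n) T)"
proof (rule Cauchy_convergent, rule metric_CauchyI)
  fix e :: real assume e: "e > 0"
  then obtain N where N: "\<And>n t. n \<ge> N \<Longrightarrow> complex_of_real t \<in> spectrum T \<Longrightarrow> dist (poly (p n) t) (f t) < e / 4"
    using lim[unfolded uniform_limit_sequentially_iff, rule_format, of "e / 4"] by auto
  have "dist (poly_op (p m) T) (poly_op (p n) T) < e" if "m \<ge> N" "n \<ge> N" for m n
  proof -
    have "norm (poly_op (p m - p n) T) \<le> e / 2"
    proof (rule norm_poly_op_le[OF T])
      show "\<bar>poly (p m - p n) t\<bar> \<le> e / 2" if "complex_of_real t \<in> spectrum T" for t
        using N[OF \<open>m \<ge> N\<close> that] N[OF \<open>n \<ge> N\<close> that]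
        unfolding dist_real_def poly_diff by linarith
    qed (use e in simp)
    with e show ?thesis by (simp add: poly_op_diff dist_norm)
  qed
  then show "\<exists>M. \<forall>m\<ge>M. \<forall>n\<ge>M. dist (poly_op (p m) T) (poly_op (p n) T) < e"
    by blast
qed

text \<open>This evaluates the definite description in \<open>fun_calc\<close>. Two approximating
  sequences differ by polynomials tending uniformly to 0 on the spectrum, so their operator limits
  agree. Working on \<open>{0..norm T}\<close>, which contains the real spectrum, avoids the
  spectrum from here on.\<close>

lemma fun_calc_tendsto:
  fixes T :: "'a::complex_hilbert_space \<Rightarrow>\<^sub>L 'a"
  assumes pos: "positive_op T"
    and lim: "uniform_limit {0..norm T} (\<lambda>n. poly (p n)) f sequentially"
  shows "(\<lambda>n. poly_op (p n) T) \<longlonglongrightarrow> fun_calc f T"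
proof -
  have T: "selfadjoint_op T" using pos by (simp add: positive_op_iff)
  define \<sigma> where "\<sigma> = {t. complex_of_real t \<in> spectrum T}"
  have "\<sigma> \<subseteq> {0..norm T}"
    using positive_op_spectrum[OF pos] by (auto simp: \<sigma>_def)
  with lim have lim': "uniform_limit \<sigma> (\<lambda>n. poly (p n)) f sequentially"
    by (rule uniform_limit_on_subset)
  then obtain S where S: "(\<lambda>n. poly_op (p n) T) \<longlonglongrightarrow> S"
    using poly_op_convergent[OF T] by (auto simp: \<sigma>_def convergent_def)
  have "fun_calc f T = S"
    unfolding fun_calc_def \<sigma>_def[symmetric]
  proof (rule the_equality)
    fix R assume "\<exists>q. uniform_limit \<sigma> (\<lambda>n. poly (q n)) f sequentially \<and> (\<lambda>n. poly_op (q n) T) \<longlonglongrightarrow> R"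
    then obtain q where q: "uniform_limit \<sigma> (\<lambda>n. poly (q n)) f sequentially"
      and R: "(\<lambda>n. poly_op (q n) T) \<longlonglongrightarrow> R" by blast
    have "uniform_limit \<sigma> (\<lambda>n. poly (q n - p n)) (\<lambda>_. 0) sequentially"
      using uniform_limit_minus[OF q lim'] by (simp add: uniform_limit_iff)
    then have "(\<lambda>n. poly_op (q n) T - poly_op (p n) T) \<longlonglongrightarrow> 0"
      using poly_op_tendsto_0[OF T, of "\<lambda>n. q n - p n"] by (simp add: \<sigma>_def poly_op_diff)
    moreover have "(\<lambda>n. poly_op (q n) T - poly_op (p n) T) \<longlonglongrightarrow> R - S"
      by (intro tendsto_diff R S)
    ultimately show "R = S"
      using LIMSEQ_unique by fastforce
  qed (use lim' S in blast)
  with S show ?thesis by simp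
qed

lemma ex_poly_uniform_limit:
  fixes f :: "real \<Rightarrow> real"
  assumes "compact S" "continuous_on S f"
  obtains p where "uniform_limit S (\<lambda>n. poly (p n)) f sequentially"
proof -
  obtain g where g: "uniform_limit S g f sequentially" "\<And>n. polynomial_function (g n)"
    using Stone_Weierstrass_uniform_limit[OF assms] by blast
  have "\<exists>p. g n = poly p" for n
  proof -
    obtain a m where "g n = (\<lambda>x. \<Sum>i\<le>m. a i * x ^ i)"
      using real_polynomial_function_imp_sum[of "g n"] g(2) by (auto simp: real_polynomial_function_eq)
    then have "g n = poly (\<Sum>i\<le>m. monom (a i) i)"
      by (simp add: poly_sum poly_monom fun_eq_iff)
    then show ?thesis ..
  qed
  then obtain p where "\<And>n. g n = poly (p n)" by metis
  then have "g = (\<lambda>n. poly (p n))" by (rule ext)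
  with g(1) that show thesis by blast
qed

context
  fixes T :: "'a::complex_hilbert_space \<Rightarrow>\<^sub>L 'a"
  assumes pos: "positive_op T"
begin

lemma fun_calc_approx:
  assumes "continuous_on {0..norm T} f"
  obtains p where "uniform_limit {0..norm T} (\<lambda>n. poly (p n)) f sequentially"
    "(\<lambda>n. poly_op (p n) T) \<longlonglongrightarrow> fun_calc f T"
proof -
  obtain p where p: "uniform_limit {0..norm T} (\<lambda>n. poly (p n)) f sequentially"
    using ex_poly_uniform_limit[OF compact_Icc assms] .
  show thesis
    by (rule that[OF p fun_calc_tendsto[OF pos p]])
qed

lemma fun_calc_cong:
  assumes "continuous_on {0..norm T} f" "\<And>t. t \<in> {0..norm T} \<Longrightarrow> f t = g t"
  shows "fun_calc f T = fun_calc g T"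
proof -
  obtain p where p: "uniform_limit {0..norm T} (\<lambda>n. poly (p n)) f sequentially"
      "(\<lambda>n. poly_op (p n) T) \<longlonglongrightarrow> fun_calc f T"
    using fun_calc_approx[OF assms(1)] .
  have "uniform_limit {0..norm T} (\<lambda>n. poly (p n)) g sequentially"
    using p(1) uniform_limit_cong'[of "{0..norm T}" "\<lambda>n. poly (p n)" "\<lambda>n. poly (p n)" f g] assms(2) by simp
  from fun_calc_tendsto[OF pos this] p(2) show ?thesis
    using LIMSEQ_unique by blast
qed

lemma fun_calc_one: "fun_calc (\<lambda>_. 1) T = id_blinfun"
proof -
  have "(\<lambda>n::nat. poly_op [:1:] T) \<longlonglongrightarrow> fun_calc (\<lambda>_. 1) T"
    by (rule fun_calc_tendsto[OF pos]) (simp add: uniform_limit_iff)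
  then show ?thesis
    by (simp add: poly_op_const LIMSEQ_const_iff)
qed

lemma selfadjoint_fun_calc:
  assumes "continuous_on {0..norm T} f"
  shows "selfadjoint_op (fun_calc f T)"
proof -
  obtain p where p: "(\<lambda>n. poly_op (p n) T) \<longlonglongrightarrow> fun_calc f T"
    using fun_calc_approx[OF assms] .
  have "selfadjoint_op (poly_op (p n) T)" for n
    using pos by (simp add: positive_op_iff selfadjoint_poly_op)
  from this p show ?thesis
    by (rule selfadjoint_lim)
qed

lemma fun_calc_linear:
  assumes f: "continuous_on {0..norm T} f" and g: "continuous_on {0..norm T} g"
  shows "fun_calc (\<lambda>t. a * f t + b * g t) T = a *\<^sub>R fun_calc f T + b *\<^sub>R fun_calc g T"
proof -
  obtain p where p: "uniform_limit {0..norm T} (\<lambda>n. poly (p n)) f sequentially"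
      "(\<lambda>n. poly_op (p n) T) \<longlonglongrightarrow> fun_calc f T"
    using fun_calc_approx[OF f] .
  obtain q where q: "uniform_limit {0..norm T} (\<lambda>n. poly (q n)) g sequentially"
      "(\<lambda>n. poly_op (q n) T) \<longlonglongrightarrow> fun_calc g T"
    using fun_calc_approx[OF g] .
  have "uniform_limit {0..norm T} (\<lambda>n t. a *\<^sub>R poly (p n) t + b *\<^sub>R poly (q n) t)
      (\<lambda>t. a *\<^sub>R f t + b *\<^sub>R g t) sequentially"
    by (intro uniform_limit_intros p q)
  then have "uniform_limit {0..norm T} (\<lambda>n. poly (smult a (p n) + smult b (q n)))
      (\<lambda>t. a * f t + b * g t) sequentially"
    by (simp add: uniform_limit_iff)
  from fun_calc_tendsto[OF pos this]
  have "(\<lambda>n. a *\<^sub>R poly_op (p n) T + b *\<^sub>R poly_op (q n) T) \<longlonglongrightarrow> fun_calc (\<lambda>t. a * f t + b * g t) T"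
    by (simp add: poly_op_add poly_op_smult)
  moreover have "(\<lambda>n. a *\<^sub>R poly_op (p n) T + b *\<^sub>R poly_op (q n) T)
      \<longlonglongrightarrow> a *\<^sub>R fun_calc f T + b *\<^sub>R fun_calc g T"
    by (intro tendsto_intros p q)
  ultimately show ?thesis
    by (rule LIMSEQ_unique)
qed

lemma fun_calc_mult:
  assumes f: "continuous_on {0..norm T} f" and g: "continuous_on {0..norm T} g"
  shows "fun_calc (\<lambda>t. f t * g t) T = fun_calc f T o\<^sub>L fun_calc g T"
proof -
  obtain p where p: "uniform_limit {0..norm T} (\<lambda>n. poly (p n)) f sequentially"
      "(\<lambda>n. poly_op (p n) T) \<longlonglongrightarrow> fun_calc f T"
    using fun_calc_approx[OF f] .
  obtain q where q: "uniform_limit {0..norm T} (\<lambda>n. poly (q n)) g sequentially"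
      "(\<lambda>n. poly_op (q n) T) \<longlonglongrightarrow> fun_calc g T"
    using fun_calc_approx[OF g] .
  have "bounded (f ` {0..norm T})" "bounded (g ` {0..norm T})"
    using f g by (auto intro!: compact_imp_bounded compact_continuous_image)
  then have "uniform_limit {0..norm T} (\<lambda>n. poly (p n * q n)) (\<lambda>t. f t * g t) sequentially"
    using uniform_lim_mult[OF p(1) q(1)] by (simp add: uniform_limit_iff)
  from fun_calc_tendsto[OF pos this]
  have "(\<lambda>n. poly_op (p n) T o\<^sub>L poly_op (q n) T) \<longlonglongrightarrow> fun_calc (\<lambda>t. f t * g t) T"
    by (simp add: poly_op_mult)
  moreover have "(\<lambda>n. poly_op (p n) T o\<^sub>L poly_op (q n) T) \<longlonglongrightarrow> (fun_calc f T o\<^sub>L fun_calc g T)"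
    by (intro tendsto_intros p q)
  ultimately show ?thesis
    by (rule LIMSEQ_unique)
qed

text \<open>With \<open>R\<close> the calculus of \<open>sqrt (f t)\<close>,
  \<open>f(T) = R\<^sup>2\<close> and \<open>R\<close> is self-adjoint, so the form of
  \<open>f(T)\<close> at \<open>x\<close> is \<open>(norm (R x))\<^sup>2\<close>.\<close>

lemma positive_fun_calc:
  assumes f: "continuous_on {0..norm T} f" and nonneg: "\<And>t. t \<in> {0..norm T} \<Longrightarrow> 0 \<le> f t"
  shows "positive_op (fun_calc f T)"
proof -
  define R where "R = fun_calc (\<lambda>t. sqrt (f t)) T"
  have c: "continuous_on {0..norm T} (\<lambda>t. sqrt (f t))"
    by (intro continuous_intros f)
  have "fun_calc f T = fun_calc (\<lambda>t. sqrt (f t) * sqrt (f t)) T"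
    using nonneg by (intro fun_calc_cong f) auto
  then have "fun_calc f T = R o\<^sub>L R"
    by (simp only: fun_calc_mult[OF c c] R_def)
  moreover have "selfadjoint_op R"
    unfolding R_def by (rule selfadjoint_fun_calc[OF c])
  ultimately show ?thesis
    using selfadjoint_fun_calc[OF f] by (simp add: positive_op_iff selfadjointD cinner_self del: of_real_power)
qed

subsection \<open>Powers of a positive operator\<close>

lemma continuous_on_op_powr_fun:
  "0 \<le> s \<Longrightarrow> continuous_on {0..norm T} (\<lambda>t. if s = 0 then 1 else t powr s)"
  using continuous_on_powr'[OF continuous_on_id continuous_on_const, of "{0..norm T}" s]
  by (cases "s = 0") (simp_all add: continuous_on_const)

lemma positive_op_powr: "0 \<le> s \<Longrightarrow> positive_op (op_powr T s)"
  unfolding op_powr_def by (intro positive_fun_calc continuous_on_op_powr_fun) auto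

lemma op_powr_0: "op_powr T 0 = id_blinfun"
  by (simp add: op_powr_def fun_calc_one)

lemma op_powr_add:
  assumes "0 \<le> s" "0 \<le> u"
  shows "op_powr T (s + u) = op_powr T s o\<^sub>L op_powr T u"
proof -
  have "fun_calc (\<lambda>t. (if s = 0 then 1 else t powr s) * (if u = 0 then 1 else t powr u)) T
      = op_powr T s o\<^sub>L op_powr T u"
    unfolding op_powr_def using assms by (intro fun_calc_mult continuous_on_op_powr_fun)
  moreover have "(\<lambda>t. (if s = 0 then 1 else t powr s) * (if u = 0 then 1 else t powr u))
      = (\<lambda>t. if s + u = 0 then 1 else t powr (s + u))"
    using assms by (auto simp: powr_add fun_eq_iff)
  ultimately show ?thesis
    by (simp add: op_powr_def)
qed

lemma norm_op_powr_sq: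
  assumes "0 \<le> s"
  shows "(norm (op_powr T s x))\<^sup>2 = Re (cinner (op_powr T (2 * s) x) x)"
  using op_powr_add[OF assms assms] positive_op_powr[OF assms]
  by (simp add: positive_op_iff selfadjointD cinner_self del: of_real_power)

text \<open>As a function of \<open>t powr r\<close>, the power \<open>t powr s\<close> is concave
  and lies below its tangent at \<open>t = l\<close>. The functional calculus carries this scalar
  inequality over to the forms.\<close>

lemma op_powr_tangent:
  assumes s: "0 < s" "s \<le> r" and l: "0 < l" and x: "norm x = 1"
  shows "Re (cinner (op_powr T s x) x)
    \<le> s / r * l powr (s - r) * Re (cinner (op_powr T r x) x) + (1 - s / r) * l powr s"
proof -
  define f where "f = (\<lambda>t::real. if r = 0 then 1 else t powr r)"
  define g where "g = (\<lambda>t::real. if s = 0 then 1 else t powr s)"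
  define \<alpha> \<beta> where "\<alpha> = s / r * l powr (s - r)" and "\<beta> = (1 - s / r) * l powr s"
  have c: "continuous_on {0..norm T} f" "continuous_on {0..norm T} g"
    unfolding f_def g_def by (rule continuous_on_op_powr_fun, use s in simp)+
  have le: "0 \<le> 1 * (\<alpha> * f t + \<beta> * 1) + (- 1) * g t" if "t \<in> {0..norm T}" for t
  proof (cases "t = 0")
    case True
    then show ?thesis using s by (simp add: f_def g_def \<beta>_def)
  next
    case False
    with that have t: "t > 0" by simp
    \<comment> \<open>Young's inequality with weights \<open>s / r\<close> and
      \<open>1 - s / r\<close>; multiplying by \<open>l powr (s - r)\<close> isolates
      \<open>t powr s\<close>.\<close>
    have "(t powr r) powr (s / r) * (l powr r) powr (1 - s / r) \<le> s / r * t powr r + (1 - s / r) * l powr r"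
      using s t l by (intro Youngs_inequality_0) auto
    then have "l powr (s - r) * (t powr s * l powr (r - s))
        \<le> l powr (s - r) * (s / r * t powr r + (1 - s / r) * l powr r)"
      using s t l by (intro mult_left_mono) (auto simp: powr_powr right_diff_distrib)
    also have "l powr (s - r) * (t powr s * l powr (r - s)) = t powr s * l powr ((s - r) + (r - s))"
      by (simp only: powr_add mult_ac)
    also have "l powr (s - r) * (s / r * t powr r + (1 - s / r) * l powr r)
        = \<alpha> * t powr r + (1 - s / r) * l powr ((s - r) + r)"
      unfolding \<alpha>_def by (simp only: powr_add distrib_left mult_ac)
    finally show ?thesis
      using s t l by (simp add: f_def g_def \<beta>_def)
  qed
  have c1: "continuous_on {0..norm T} (\<lambda>t. \<alpha> * f t + \<beta> * 1)"
    by (intro continuous_intros c)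
  have "positive_op (fun_calc (\<lambda>t. 1 * (\<alpha> * f t + \<beta> * 1) + (- 1) * g t) T)"
    using le by (intro positive_fun_calc continuous_intros c) auto
  also have "fun_calc (\<lambda>t. 1 * (\<alpha> * f t + \<beta> * 1) + (- 1) * g t) T
      = 1 *\<^sub>R (\<alpha> *\<^sub>R fun_calc f T + \<beta> *\<^sub>R id_blinfun) + (- 1) *\<^sub>R fun_calc g T"
    by (subst fun_calc_linear[OF c1 c(2)], subst fun_calc_linear[OF c(1)]) (simp_all add: fun_calc_one)
  finally have "positive_op (1 *\<^sub>R (\<alpha> *\<^sub>R op_powr T r + \<beta> *\<^sub>R id_blinfun) + (- 1) *\<^sub>R op_powr T s)"
    by (simp add: op_powr_def f_def g_def)
  then have "0 \<le> Re (cinner ((1 *\<^sub>R (\<alpha> *\<^sub>R op_powr T r + \<beta> *\<^sub>R id_blinfun) + (- 1) *\<^sub>R op_powr T s) x) x)"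
    by (simp only: positive_op_iff)
  also have "\<dots> = \<alpha> * Re (cinner (op_powr T r x) x) + \<beta> - Re (cinner (op_powr T s x) x)"
    by (simp add: blinfun.add_left blinfun.diff_left blinfun.scaleR_left cinner.add_left
        cinner.diff_left cinner.scaleR_left cinner_self x)
  finally show ?thesis
    by (simp add: \<alpha>_def \<beta>_def)
qed

text \<open>Obtained from the tangent bound by choosing the point of tangency \<open>l\<close>. The
  case \<open>s = 0\<close> is separate because the zeroth power is the identity whereas
  \<open>0 powr 0 = 0\<close>.\<close>

lemma op_powr_McCarthy:
  assumes s: "0 \<le> s" "s \<le> r" and x: "norm x = 1"
  shows "Re (cinner (op_powr T s x) x)
    \<le> (if s = 0 then 1 else Re (cinner (op_powr T r x) x) powr (s / r))"
proof (cases "s = 0")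
  case True
  then show ?thesis by (simp add: op_powr_0 cinner_self x)
next
  case False
  with s have s0: "0 < s" and r0: "0 < r" by auto
  define q where "q = (\<lambda>s. Re (cinner (op_powr T s x) x))"
  have tangent: "q s \<le> s / r * l powr (s - r) * q r + (1 - s / r) * l powr s" if "0 < l" for l
    using op_powr_tangent[OF s0 s(2) that x] by (simp add: q_def)
  have "0 \<le> q r"
    using positive_op_powr[of r] r0 by (simp add: q_def positive_op_iff)
  then consider "q r > 0" | "q r = 0" by linarith
  then have "q s \<le> q r powr (s / r)"
  proof cases
    case 1
    \<comment> \<open>The optimal point, \<open>l powr r = q r\<close>: both terms of the tangent
      bound become multiples of \<open>q r powr (s / r)\<close>, with coefficients summing to
      1.\<close>
    define l where "l = q r powr (1 / r)"
    have "l powr (s - r) * q r = q r powr ((s - r) / r + 1)"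
      using 1 by (simp add: l_def powr_powr powr_add)
    also have "(s - r) / r + 1 = s / r"
      using r0 by (simp add: field_simps)
    finally have "l powr (s - r) * q r = q r powr (s / r)" .
    moreover have "l powr s = q r powr (s / r)"
      by (simp add: l_def powr_powr)
    moreover have "l > 0" using 1 by (simp add: l_def)
    ultimately show ?thesis
      using tangent[of l] by (simp add: mult.assoc left_diff_distrib)
  next
    case 2
    show ?thesis
    proof (rule ccontr)
      assume "\<not> ?thesis"
      with 2 have qs: "q s > 0" by simp
      \<comment> \<open>With \<open>q r = 0\<close> the tangent bound reads
        \<open>q s \<le> (1 - s / r) * l powr s\<close>; taking \<open>l powr s = q s / 2\<close>
        contradicts \<open>q s > 0\<close>.\<close>
      define l where "l = (q s / 2) powr (1 / s)"
      have l: "l powr s = q s / 2" "0 < l"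
        using qs s0 by (simp_all add: l_def powr_powr)
      have "q s \<le> (1 - s / r) * (q s / 2)"
        using tangent[OF l(2)] unfolding l(1) 2 by simp
      also have "\<dots> \<le> 1 * (q s / 2)"
        using qs s0 r0 by (intro mult_right_mono) auto
      finally show False using qs by simp
    qed
  qed
  with False show ?thesis by (simp add: q_def)
qed

end

subsection \<open>The refined Young inequality\<close>

text \<open>For positive \<open>a\<close>, \<open>b\<close> and \<open>k \<le> m\<close> with
  \<open>m > 0\<close> this is \<open>a powr (k / m) * b powr (1 - k / m)\<close>. Natural powers
  under a root match the shape of \<open>eta\<close>, and \<open>0 ^ 0 = 1\<close> gives the end
  nodes their values \<open>b\<close> and \<open>a\<close>.\<close>

definition geo_mean :: "real \<Rightarrow> real \<Rightarrow> nat \<Rightarrow> nat \<Rightarrow> real" where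
  "geo_mean a b m k = root m (b ^ (m - k) * a ^ k)"

text \<open>
  The value at \<open>\<nu>\<close> of the piecewise linear interpolant of \<open>t \<mapsto> a powr t * b powr (1 - t)\<close> with
  nodes \<open>k / m\<close>.  The \<open>j\<close>-th term of \<open>\<eta>\<close> is the correction from \<open>m = 2 ^ (j - 1)\<close> to \<open>m = 2 ^ j\<close>.
\<close>

definition geo_interp :: "real \<Rightarrow> real \<Rightarrow> real \<Rightarrow> nat \<Rightarrow> real" where
  "geo_interp \<nu> a b m = (let k = nat \<lfloor>real m * \<nu>\<rfloor>
     in (real k + 1 - real m * \<nu>) * geo_mean a b m k + (real m * \<nu> - real k) * geo_mean a b m (k + 1))"

definition eta_term :: "real \<Rightarrow> real \<Rightarrow> real \<Rightarrow> nat \<Rightarrow> real" where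
  "eta_term \<nu> a b j = (let rj = nat \<lfloor>2 ^ j * \<nu>\<rfloor>; kj = nat \<lfloor>2 ^ (j - 1) * \<nu>\<rfloor>
     in ((-1) ^ rj * 2 ^ (j - 1) * \<nu> + (-1) ^ (rj + 1) * of_int \<lfloor>(real rj + 1) / 2\<rfloor>) *
        (root (2 ^ j) (b ^ (2 ^ (j - 1) - kj) * a ^ kj) -
         root (2 ^ j) (a ^ (kj + 1) * b ^ (2 ^ (j - 1) - kj - 1)))\<^sup>2)"

lemma eta_eq_sum:
  "eta \<nu> r N A B x = (\<Sum>j=1..N. eta_term \<nu> (Re (cinner (op_powr A r x) x)) (Re (cinner (op_powr B r x) x)) j)"
  unfolding eta_def eta_term_def Let_def ..

lemma geo_mean_nonneg: "0 \<le> a \<Longrightarrow> 0 \<le> b \<Longrightarrow> 0 \<le> geo_mean a b m k"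
  by (cases "m = 0") (simp_all add: geo_mean_def)

text \<open>Old nodes survive bisection as the even nodes.\<close>

lemma geo_mean_double:
  assumes "0 \<le> a" "0 \<le> b" "m > 0"
  shows "geo_mean a b (2 * m) (2 * k) = geo_mean a b m k"
proof -
  have "geo_mean a b (2 * m) (2 * k) = root m (sqrt ((b ^ (m - k) * a ^ k)\<^sup>2))"
    unfolding geo_mean_def sqrt_def mult.commute[of 2 m] real_root_mult_exp[symmetric]
    by (simp add: power_mult_distrib flip: power_mult) (simp add: mult.commute diff_mult_distrib)
  then show ?thesis
    using assms by (simp add: geo_mean_def)
qed

text \<open>The new odd node is the geometric mean of its two neighbours.\<close>

lemma sqrt_geo_mean_mult:
  assumes "k < m"
  shows "sqrt (geo_mean a b m k) * sqrt (geo_mean a b m (k + 1)) = geo_mean a b (2 * m) (2 * k + 1)"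
proof -
  have "(m - k) + (m - (k + 1)) = 2 * m - (2 * k + 1)" "k + (k + 1) = 2 * k + 1"
    using assms by auto
  then have "(b ^ (m - k) * a ^ k) * (b ^ (m - (k + 1)) * a ^ (k + 1)) = b ^ (2 * m - (2 * k + 1)) * a ^ (2 * k + 1)"
    by (metis (no_types, lifting) power_add mult.assoc mult.left_commute)
  then show ?thesis
    unfolding geo_mean_def sqrt_def
    by (simp only: real_root_mult_exp[symmetric] real_root_mult[symmetric])
qed

text \<open>The parity of \<open>r_j\<close> tells in which half of its cell of width
  \<open>1 / 2 ^ n\<close> the point \<open>\<nu>\<close> lies. The coefficient is the scaled
  distance from \<open>\<nu>\<close> to the endpoint of that half which is an old node.\<close>

lemma eta_term_cases:
  assumes "0 \<le> \<nu>" "\<nu> < 1"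
  obtains (even) k where "k < 2 ^ n" "nat \<lfloor>2 ^ n * \<nu>\<rfloor> = k" "nat \<lfloor>2 ^ Suc n * \<nu>\<rfloor> = 2 * k" "k \<le> 2 ^ n * \<nu>"
    "eta_term \<nu> a b (Suc n) = (2 ^ n * \<nu> - k) * (sqrt (geo_mean a b (2 ^ n) k) - sqrt (geo_mean a b (2 ^ n) (k + 1)))\<^sup>2"
  | (odd) k where "k < 2 ^ n" "nat \<lfloor>2 ^ n * \<nu>\<rfloor> = k" "nat \<lfloor>2 ^ Suc n * \<nu>\<rfloor> = 2 * k + 1" "2 ^ n * \<nu> < real k + 1"
    "eta_term \<nu> a b (Suc n) = (k + 1 - 2 ^ n * \<nu>) * (sqrt (geo_mean a b (2 ^ n) k) - sqrt (geo_mean a b (2 ^ n) (k + 1)))\<^sup>2"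
proof -
  define k where "k = nat \<lfloor>2 ^ n * \<nu>\<rfloor>"
  define r where "r = nat \<lfloor>2 ^ Suc n * \<nu>\<rfloor>"
  have k: "real k \<le> 2 ^ n * \<nu>" "2 ^ n * \<nu> < real k + 1"
    using assms(1) by (auto simp: k_def)
  have r: "real r \<le> 2 * 2 ^ n * \<nu>" "2 * 2 ^ n * \<nu> < real r + 1"
    using assms(1) by (auto simp: r_def)
  have "2 ^ n * \<nu> < 2 ^ n * 1"
    using assms(2) by (intro mult_strict_left_mono) auto
  with k(1) have "real k < 2 ^ n" by linarith
  then have kn: "k < 2 ^ n" by simp
  define c where "c = (-1) ^ r * 2 ^ n * \<nu> + (-1) ^ (r + 1) * of_int \<lfloor>(real r + 1) / 2\<rfloor>"
  \<comment> \<open>Roots of order \<open>2 ^ Suc n\<close> are square roots of the node values on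
    the mesh of \<open>2 ^ n\<close> cells.\<close>
  have "(root (2 ^ Suc n) (b ^ (2 ^ n - k) * a ^ k) - root (2 ^ Suc n) (a ^ (k + 1) * b ^ (2 ^ n - k - 1)))\<^sup>2
     = (sqrt (geo_mean a b (2 ^ n) k) - sqrt (geo_mean a b (2 ^ n) (k + 1)))\<^sup>2"
    unfolding geo_mean_def sqrt_def real_root_mult_exp[symmetric] by (simp add: mult.commute)
  then have et: "eta_term \<nu> a b (Suc n) = c * (sqrt (geo_mean a b (2 ^ n) k) - sqrt (geo_mean a b (2 ^ n) (k + 1)))\<^sup>2"
    unfolding eta_term_def Let_def diff_Suc_1 r_def[symmetric] k_def[symmetric] c_def[symmetric] by simp
  have "real (2 * k) < real r + 1" "real r < real (2 * k + 2)"
    using k r by (auto simp: algebra_simps)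
  then have "2 * k < r + 1" "r < 2 * k + 2" by linarith+
  then consider "r = 2 * k" | "r = 2 * k + 1" by linarith
  then show thesis
  proof cases
    case 1
    have "\<lfloor>(real r + 1) / 2\<rfloor> = int k"
      unfolding 1 by (intro floor_unique) auto
    then have "c = 2 ^ n * \<nu> - real k" by (simp add: c_def 1)
    with 1 et show thesis
      by (intro even[OF kn k_def[symmetric] _ k(1)]) (simp_all only: r_def[symmetric])
  next
    case 2
    have "\<lfloor>(real r + 1) / 2\<rfloor> = int k + 1"
      unfolding 2 by (intro floor_unique) auto
    then have "c = real k + 1 - 2 ^ n * \<nu>" by (simp add: c_def 2)
    with 2 et show thesis
      by (intro odd[OF kn k_def[symmetric] _ k(2)]) (simp_all only: r_def[symmetric])
  qed
qed

lemma eta_term_nonneg: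
  assumes "0 \<le> \<nu>" "\<nu> < 1"
  shows "0 \<le> eta_term \<nu> a b (Suc n)"
  using assms
proof (cases rule: eta_term_cases[where n = n and a = a and b = b])
  case (even k)
  show ?thesis
    unfolding even(5) using even(4) by (intro mult_nonneg_nonneg) simp_all
next
  case (odd k)
  show ?thesis
    unfolding odd(5) using odd(4) by (intro mult_nonneg_nonneg) simp_all
qed

lemma geo_interp_double:
  assumes \<nu>: "0 \<le> \<nu>" "\<nu> < 1" and ab: "0 \<le> a" "0 \<le> b"
  shows "geo_interp \<nu> a b (2 ^ n) - eta_term \<nu> a b (Suc n) = geo_interp \<nu> a b (2 ^ Suc n)"
proof -
  define P Q where "P = geo_mean a b (2 ^ n)" and "Q = geo_mean a b (2 ^ Suc n)"
  have Q: "Q (2 * k) = P k" "Q (2 * k + 1 + 1) = P (k + 1)" for k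
    using geo_mean_double[OF ab, of "2 ^ n" k] geo_mean_double[OF ab, of "2 ^ n" "k + 1"]
    by (simp_all add: P_def Q_def)
  \<comment> \<open>The square is twice the gap between the midpoint of the old chord and the new
    node; the coefficient of the term scales this to the drop of the interpolant at
    \<open>\<nu>\<close>.\<close>
  have sq: "(sqrt (P k) - sqrt (P (k + 1)))\<^sup>2 = P k + P (k + 1) - 2 * Q (2 * k + 1)" if "k < 2 ^ n" for k
    using sqrt_geo_mean_mult[OF that, of a b] geo_mean_nonneg[OF ab, of "2 ^ n"]
    by (simp add: P_def Q_def power2_diff)
  have L: "geo_interp \<nu> a b (2 ^ n) = (let k = nat \<lfloor>2 ^ n * \<nu>\<rfloor>
      in (real k + 1 - 2 ^ n * \<nu>) * P k + (2 ^ n * \<nu> - real k) * P (k + 1))"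
    "geo_interp \<nu> a b (2 ^ Suc n) = (let k = nat \<lfloor>2 ^ Suc n * \<nu>\<rfloor>
      in (real k + 1 - 2 * 2 ^ n * \<nu>) * Q k + (2 * 2 ^ n * \<nu> - real k) * Q (k + 1))"
    by (simp_all add: geo_interp_def P_def Q_def)
  show ?thesis
    using \<nu>
  proof (cases rule: eta_term_cases[where n = n and a = a and b = b])
    case (even k)
    then show ?thesis
      unfolding L even(2,3,5) Let_def P_def[symmetric] sq[OF even(1)] Q by (simp add: algebra_simps)
  next
    case (odd k)
    then show ?thesis
      unfolding L odd(2,3,5) Let_def P_def[symmetric] sq[OF odd(1)] Q by (simp add: algebra_simps)
  qed
qed

text \<open>Telescoping over bisections, starting from the single chord
  \<open>\<nu> * a + (1 - \<nu>) * b\<close>.\<close>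

lemma geo_interp_eq_sum:
  assumes "0 \<le> \<nu>" "\<nu> < 1" "0 \<le> a" "0 \<le> b"
  shows "geo_interp \<nu> a b (2 ^ N) = \<nu> * a + (1 - \<nu>) * b - (\<Sum>j=1..N. eta_term \<nu> a b j)"
proof (induction N)
  case 0
  have "nat \<lfloor>\<nu>\<rfloor> = 0"
    using assms by (simp add: floor_eq_iff)
  then show ?case
    by (simp add: geo_interp_def geo_mean_def)
next
  case (Suc N)
  then show ?case
    using geo_interp_double[OF assms, of N] by simp
qed

lemma geo_interp_ge:
  assumes \<nu>: "0 < \<nu>" "\<nu> < 1" and ab: "0 \<le> a" "0 \<le> b" and m: "m > 0"
  shows "a powr \<nu> * b powr (1 - \<nu>) \<le> geo_interp \<nu> a b m"
proof -
  define k where "k = nat \<lfloor>real m * \<nu>\<rfloor>"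
  \<comment> \<open>The relative position of \<open>\<nu>\<close> in its cell. Young's inequality
    with weights \<open>1 - s\<close> and \<open>s\<close> on the two neighbouring nodes returns
    exactly the exponents \<open>\<nu>\<close> and \<open>1 - \<nu>\<close>.\<close>
  define s where "s = real m * \<nu> - real k"
  have s: "0 \<le> s" "s < 1"
  proof -
    have "real k = of_int \<lfloor>real m * \<nu>\<rfloor>"
      using \<nu>(1) by (simp add: k_def)
    then show "0 \<le> s" "s < 1"
      using floor_correct[of "real m * \<nu>"] unfolding s_def by linarith+
  qed
  have "real m * \<nu> < real m * 1"
    using \<nu>(2) m by (intro mult_strict_left_mono) auto
  then have km: "k < m"
    using s(1) by (simp add: s_def)
  have L: "geo_interp \<nu> a b m = (1 - s) * geo_mean a b m k + s * geo_mean a b m (k + 1)"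
    unfolding geo_interp_def Let_def k_def[symmetric] by (simp add: s_def)
  show ?thesis
  proof (cases "a = 0 \<or> b = 0")
    case True
    then have "a powr \<nu> * b powr (1 - \<nu>) = 0" by auto
    moreover have "0 \<le> geo_interp \<nu> a b m"
      using s unfolding L by (intro add_nonneg_nonneg mult_nonneg_nonneg geo_mean_nonneg ab) auto
    ultimately show ?thesis by linarith
  next
    case False
    with ab have a: "a > 0" and b: "b > 0" by auto
    have geo_mean: "geo_mean a b m i = a powr (i / m) * b powr (1 - i / m)" if "i \<le> m" for i
    proof -
      have "geo_mean a b m i = (b powr real (m - i) * a powr real i) powr (1 / m)"
        using a b m by (simp add: geo_mean_def root_powr_inverse powr_realpow)
      also have "\<dots> = a powr (i / m) * b powr (real (m - i) / m)"
        using a b by (simp add: powr_mult powr_powr)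
      also have "real (m - i) / m = 1 - i / m"
        using that m by (simp add: of_nat_diff diff_divide_distrib)
      finally show ?thesis .
    qed
    have "geo_mean a b m k powr (1 - s) * geo_mean a b m (k + 1) powr s \<le> (1 - s) * geo_mean a b m k + s * geo_mean a b m (k + 1)"
      using s a b km by (intro Youngs_inequality_0) (auto simp: geo_mean)
    moreover have "geo_mean a b m k powr (1 - s) * geo_mean a b m (k + 1) powr s
      = a powr (k / m * (1 - s) + real (k + 1) / m * s)
        * b powr ((1 - k / m) * (1 - s) + (1 - real (k + 1) / m) * s)"
      using km by (simp add: geo_mean powr_mult powr_powr powr_add del: of_nat_Suc of_nat_add)
    moreover have "k / m * (1 - s) + real (k + 1) / m * s = \<nu>"
      using m by (simp add: s_def field_simps)
    moreover have "(1 - k / m) * (1 - s) + (1 - real (k + 1) / m) * s = 1 - \<nu>"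
      using m by (simp add: s_def field_simps)
    ultimately show ?thesis by (simp add: L)
  qed
qed

text \<open>Here \<open>r_j = 2 ^ Suc n\<close> is even and the coefficient is
  \<open>2 ^ n - 2 ^ n\<close>, so the truncated exponent has no effect.\<close>

lemma eta_term_one: "eta_term 1 a b (Suc n) = 0"
proof -
  have "\<lfloor>(real (2 ^ Suc n) + 1) / 2\<rfloor> = 2 ^ n"
    by (rule floor_unique) auto
  moreover have "nat \<lfloor>2 ^ Suc n * (1::real)\<rfloor> = 2 ^ Suc n"
  proof -
    have "2 ^ Suc n * (1::real) = real (2 ^ Suc n)" by simp
    then show ?thesis by (simp only: floor_of_nat nat_int)
  qed
  ultimately show ?thesis
    unfolding eta_term_def Let_def by simp
qed

lemma sum_eta_term_nonneg:
  assumes "0 \<le> \<nu>" "\<nu> \<le> 1"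
  shows "0 \<le> (\<Sum>j=1..N. eta_term \<nu> a b j)"
proof (rule sum_nonneg)
  fix j assume "j \<in> {1..N}"
  then obtain n where "j = Suc n" by (cases j) auto
  then show "0 \<le> eta_term \<nu> a b j"
    using assms eta_term_nonneg[of \<nu> a b n] eta_term_one[of a b n] by (cases "\<nu> = 1") auto
qed

lemma refined_Young:
  assumes \<nu>: "0 \<le> \<nu>" "\<nu> \<le> 1" and ab: "0 \<le> a" "0 \<le> b"
  shows "(if \<nu> = 0 then 1 else a powr \<nu>) * (if 1 - \<nu> = 0 then 1 else b powr (1 - \<nu>))
    \<le> \<nu> * a + (1 - \<nu>) * b - (\<Sum>j=1..N. eta_term \<nu> a b j)"
proof -
  consider "\<nu> = 0" | "\<nu> = 1" | "0 < \<nu>" "\<nu> < 1" using \<nu> by linarith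
  then show ?thesis
  proof cases
    case 1
    \<comment> \<open>At \<open>\<nu> = 0\<close> the interpolant takes its end-node value, so the
      bound is an equality.\<close>
    have "geo_interp 0 a b (2 ^ N) = b"
      using ab by (simp add: geo_interp_def geo_mean_def real_root_power_cancel)
    then show ?thesis
      using 1 ab geo_interp_eq_sum[of \<nu> a b N] by simp
  next
    case 2
    have "(\<Sum>j=1..N. eta_term 1 a b j) = 0"
    proof (rule sum.neutral, rule ballI)
      fix j assume "j \<in> {1..N}"
      then show "eta_term 1 a b j = 0"
        using eta_term_one[of a b "j - 1"] by simp
    qed
    with 2 ab show ?thesis by simp
  next
    case 3
    then show ?thesis
      using geo_interp_ge[OF 3 ab, of "2 ^ N"] geo_interp_eq_sum[of \<nu> a b N] ab by simp
  qed
qed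

subsection \<open>The numerical radius inequality\<close>

text \<open>The squared norm is the form of the power \<open>2 * s\<close>. McCarthy's inequality
  applies because \<open>2 * s \<le> 2 \<le> r\<close>; raising to the power \<open>r / 2\<close>
  then leaves the exponent \<open>s\<close>.\<close>

lemma norm_op_powr_powr_le:
  assumes T: "positive_op T" and s: "0 \<le> s" "s \<le> 1" and r: "2 \<le> r" and x: "norm x = 1"
  shows "norm (op_powr T s x) powr r
    \<le> (if s = 0 then 1 else Re (cinner (op_powr T r x) x) powr s)"
proof -
  define q where "q = Re (cinner (op_powr T r x) x)"
  have le: "(norm (op_powr T s x))\<^sup>2 \<le> (if 2 * s = 0 then 1 else q powr (2 * s / r))"
    unfolding norm_op_powr_sq[OF T s(1)] q_def
    using s r by (intro op_powr_McCarthy[OF T _ _ x]) auto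
  have "norm (op_powr T s x) powr r = ((norm (op_powr T s x))\<^sup>2) powr (r / 2)"
    by (simp add: powr_powr flip: powr_numeral)
  also have "\<dots> \<le> (if 2 * s = 0 then 1 else q powr (2 * s / r)) powr (r / 2)"
    using r by (intro powr_mono2 le) simp_all
  also have "\<dots> = (if s = 0 then 1 else q powr s)"
    using r by (simp add: powr_powr)
  finally show ?thesis by (simp only: q_def)
qed

theorem theorem2p3:
  fixes A B X :: "'a::complex_hilbert_space \<Rightarrow>\<^sub>L 'a"
    and r \<nu> :: real and N :: nat
  assumes "A \<in> bounded_ops" and "B \<in> bounded_ops" and "X \<in> bounded_ops"
    and "positive_op A" and "positive_op B"
    and "2 \<le> r" and "0 \<le> \<nu>" and "\<nu> \<le> 1" and "1 \<le> N"
  shows "numerical_radius (op_powr A \<nu> o\<^sub>L X o\<^sub>L op_powr B (1 - \<nu>)) powr r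
    \<le> norm X powr r *
      (norm (\<nu> *\<^sub>R op_powr A r + (1 - \<nu>) *\<^sub>R op_powr B r)
        - (INF x\<in>{x. norm x = 1}. eta \<nu> r N A B x))"
proof (cases "\<exists>x::'a. norm x = 1")
  case False
  \<comment> \<open>Without unit vectors the space is zero. The infimum is then over the empty set,
    but it is multiplied by \<open>norm X powr r = 0\<close>.\<close>
  have "norm X = 0"
  proof -
    have zero: "x = 0" for x :: 'a
      using False by (metis norm_sgn)
    have "X = 0"
      by (rule blinfun_eqI) (metis zero)
    then show ?thesis by simp
  qed
  moreover from False have "numerical_radius (op_powr A \<nu> o\<^sub>L X o\<^sub>L op_powr B (1 - \<nu>)) = 0"
    by (simp add: numerical_radius_def)
  ultimately show ?thesis by simp
next
  case True
  define W where "W = op_powr A \<nu> o\<^sub>L X o\<^sub>L op_powr B (1 - \<nu>)"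
  define V where "V = \<nu> *\<^sub>R op_powr A r + (1 - \<nu>) *\<^sub>R op_powr B r"
  define R where "R = norm X powr r * (norm V - (INF x\<in>{x. norm x = 1}. eta \<nu> r N A B x))"
  have le: "cmod (cinner (W x) x) powr r \<le> R" if x: "norm x = 1" for x
  proof -
    define a where "a = Re (cinner (op_powr A r x) x)"
    define b where "b = Re (cinner (op_powr B r x) x)"
    define u where "u = op_powr A \<nu> x"
    define v where "v = op_powr B (1 - \<nu>) x"
    have ab: "0 \<le> a" "0 \<le> b"
      using positive_op_powr[OF assms(4), of r] positive_op_powr[OF assms(5), of r] assms(6)
      by (auto simp: a_def b_def positive_op_iff)
    have "selfadjoint_op (op_powr A \<nu>)"
      using positive_op_powr[OF assms(4,7)] by (simp add: positive_op_iff)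
    then have "cinner (W x) x = cinner (X v) u"
      by (simp add: W_def u_def v_def selfadjointD)
    then have "cmod (cinner (W x) x) \<le> norm (X v) * norm u"
      by (simp add: Cauchy_Schwarz_cinner)
    also have "\<dots> \<le> norm X * norm v * norm u"
      by (intro mult_right_mono norm_blinfun) simp
    finally have "cmod (cinner (W x) x) powr r \<le> (norm X * norm v * norm u) powr r"
      using assms(6) by (intro powr_mono2) auto
    also have "\<dots> = norm X powr r * (norm u powr r * norm v powr r)"
      by (simp add: powr_mult)
    also have "\<dots> \<le> norm X powr r *
        ((if \<nu> = 0 then 1 else a powr \<nu>) * (if 1 - \<nu> = 0 then 1 else b powr (1 - \<nu>)))"
      unfolding u_def v_def a_def b_def using assms x
      by (intro mult_left_mono mult_mono norm_op_powr_powr_le) auto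
    also have "\<dots> \<le> norm X powr r * (\<nu> * a + (1 - \<nu>) * b - eta \<nu> r N A B x)"
      unfolding eta_eq_sum a_def[symmetric] b_def[symmetric]
      by (intro mult_left_mono refined_Young assms ab) simp
    also have "\<dots> \<le> R"
      unfolding R_def
    proof (intro mult_left_mono diff_mono)
      have "\<nu> * a + (1 - \<nu>) * b = Re (cinner (V x) x)"
        by (simp add: V_def a_def b_def blinfun.add_left blinfun.scaleR_left cinner.add_left
            cinner.scaleR_left)
      also have "\<dots> \<le> norm (V x) * norm x"
        using Cauchy_Schwarz_cinner complex_Re_le_cmod order_trans by blast
      also have "\<dots> \<le> norm V"
        using norm_blinfun[of V x] by (simp add: x)
      finally show "\<nu> * a + (1 - \<nu>) * b \<le> norm V" .
      \<comment> \<open>Nonnegativity of \<open>eta\<close> provides the lower bound that lets the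
        infimum be compared with a single value.\<close>
      have "bdd_below (eta \<nu> r N A B ` {x. norm x = 1})"
        unfolding eta_eq_sum using sum_eta_term_nonneg[OF assms(7,8)] by (intro bdd_belowI2)
      then show "(INF x\<in>{x. norm x = 1}. eta \<nu> r N A B x) \<le> eta \<nu> r N A B x"
        using x by (intro cINF_lower) auto
    qed simp
    finally show ?thesis .
  qed
  \<comment> \<open>A unit vector exists and its bound dominates a nonnegative power. Hence
    \<open>R\<close> has a nonnegative \<open>r\<close>-th root, which bounds the set under the
    supremum, including the inserted 0.\<close>
  with True have R: "0 \<le> R"
    using order_trans[OF powr_ge_zero] by blast
  have r: "r > 0" using assms(6) by simp
  have ub: "y \<le> R powr (1 / r)" if "y \<in> insert 0 {cmod (cinner (W x) x) | x. norm x = 1}" for y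
  proof (cases "y = 0")
    case False
    with that le have y: "y powr r \<le> R" "0 \<le> y" by auto
    have "(y powr r) powr (1 / r) \<le> R powr (1 / r)"
      using y r by (intro powr_mono2) auto
    then show ?thesis using y r by (simp add: powr_powr)
  qed simp
  have "numerical_radius W \<le> R powr (1 / r)"
    unfolding numerical_radius_def by (intro cSup_least ub) simp_all
  moreover have "0 \<le> numerical_radius W"
    unfolding numerical_radius_def by (intro cSup_upper bdd_aboveI[OF ub]) simp_all
  ultimately have "numerical_radius W powr r \<le> (R powr (1 / r)) powr r"
    using r by (intro powr_mono2) auto
  also have "\<dots> = R"
    using r R by (simp add: powr_powr)
  finally show ?thesis
    by (simp add: W_def R_def V_def)
qed

end
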